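(* Let $n,k\ge 1$ and let $[n]^3$ denote the complete $3$-partite $3$-uniform hypergraph with three disjoint sides $V_1,V_2,V_3$, each of size $n$, whose edges are all triples meeting each $V_j$ in exactly one vertex. If $F_1,\ldots,F_k\subseteq [n]^3$ satisfy $|F_i|>(k-1)n^{2}$ for all $i\le k$, then there exist pairwise disjoint edges $e_1,\ldots,e_k$ with $e_i\in F_i$ for every $i$ (a rainbow matching).
   Context: A rainbow matching for a collection $(F_1,\ldots,F_k)$ of hypergraphs is a choice of pairwise disjoint edges $e_i\in F_i$, one from each $F_i$. *)

theory Defs
  imports Main
begin

definition side :: "nat \<Rightarrow> nat \<Rightarrow> (nat \<times> nat) set" where
  "side n j = {(j, x) | x. x < n}"

definition complete_3partite :: "nat \<Rightarrow> (nat \<times> nat) set set" where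
  "complete_3partite n =
     {e. e \<subseteq> side n 1 \<union> side n 2 \<union> side n 3 \<and>
         (\<forall>j\<in>{1,2,3}. card (e \<inter> side n j) = 1)}"

definition rainbow_matching :: "nat \<Rightarrow> (nat \<Rightarrow> 'a set set) \<Rightarrow> (nat \<Rightarrow> 'a set) \<Rightarrow> bool" where
  "rainbow_matching k F e \<longleftrightarrow>
     (\<forall>i<k. e i \<in> F i) \<and> (\<forall>i<k. \<forall>j<k. i \<noteq> j \<longrightarrow> e i \<inter> e j = {})"

end

(*
  For the tripartite statement, assign distinct vertices v_i of V_1 to the colours so that the total
  size of the links F_i(v_i) is maximal. Averaging over cyclic injections shows that the links, which
  are bipartite graphs G_i on n + n vertices, satisfy
    sum_{i in I} |G_i| > |I| (|I| - 1) n   for every nonempty set I of colours,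
  and this Hall-type condition suffices for a rainbow matching in bipartite graphs. After compression
  the G_i are Young diagrams. Let k be the number of colours, and call a row or column of G_i heavy if
  it contains the first k cells; let h_i count the heavy lines
  of G_i among the first k rows and columns. A colour with [k] x [k] contained in G_i can be served last.
  Otherwise take a maximal set I of colours
  with sum_{i in I} h_i <= |I| (|I| - 1). If I consists of all the colours, then the sets
  G_i restricted to [k] x [k] are so dense that two random cyclic shifts of a bijection give a
  matching. Otherwise I has a rainbow matching by induction, and by maximality of I the remaining
  colours can greedily pick distinct heavy lines that avoid it; a heavy line always has room for
  one more edge.
*)

theory Submission
  imports Defs
begin

section \<open>Distinct representatives\<close>

text \<open>Apply the hypothesis to \<open>J = K\<close> and let the resulting \<open>i\<close>
  choose last: the other choices occupy at most \<open>card K - 1\<close> elements of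
  \<open>A i\<close>. The condition passes to subsets, so induction applies.\<close>

lemma greedy_representatives:
  fixes A :: "'i \<Rightarrow> 'a set"
  assumes "finite K"
    and "\<And>J. J \<subseteq> K \<Longrightarrow> J \<noteq> {} \<Longrightarrow> \<exists>i\<in>J. card J \<le> card (A i)"
  shows "\<exists>f. inj_on f K \<and> (\<forall>i\<in>K. f i \<in> A i)"
  using assms
proof (induction "card K" arbitrary: K)
  case 0
  then show ?case by auto
next
  case (Suc m)
  then have "K \<noteq> {}" by auto
  with Suc.prems obtain i where i: "i \<in> K" "card K \<le> card (A i)" by blast
  let ?K = "K - {i}"
  have m: "card ?K = m" using Suc i by simp
  have "\<exists>f. inj_on f ?K \<and> (\<forall>j\<in>?K. f j \<in> A j)"
    by (rule Suc.hyps(1)) (use Suc.prems m in auto)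
  then obtain f where f: "inj_on f ?K" "\<forall>j\<in>?K. f j \<in> A j" by blast
  have "card (f ` ?K) \<le> m" using m Suc.prems(1) card_image_le[of ?K f] by simp
  then have "card (f ` ?K) < card (A i)" using i Suc.hyps(2) by simp
  then have "\<not> A i \<subseteq> f ` ?K"
    using card_mono[of "f ` ?K" "A i"] Suc.prems(1) by auto
  then obtain a where a: "a \<in> A i" "a \<notin> f ` ?K" by blast
  let ?f = "f(i := a)"
  have "inj_on ?f K" using f(1) a(2) unfolding inj_on_def by auto
  moreover have "\<forall>j\<in>K. ?f j \<in> A j" using f(2) a(1) by auto
  ultimately show ?case by blast
qed

text \<open>Distinct numbers indexed by \<open>J\<close> cannot all be below
  \<open>card J - 1\<close>, so some \<open>i\<close> in \<open>J\<close> has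
  \<open>x i \<ge> card J - 1\<close> and hence \<open>card (A i) \<ge> card J\<close>. This undoes
  a compression: \<open>x i\<close> is a position in a compressed line, \<open>A i\<close> the
  original line.\<close>

lemma representatives_of_ranks:
  fixes A :: "'i \<Rightarrow> 'a set" and x :: "'i \<Rightarrow> nat"
  assumes "finite K" "inj_on x K" "\<And>i. i \<in> K \<Longrightarrow> x i < card (A i)"
  shows "\<exists>f. inj_on f K \<and> (\<forall>i\<in>K. f i \<in> A i)"
proof (rule greedy_representatives[OF assms(1)])
  fix J assume J: "J \<subseteq> K" "J \<noteq> {}"
  have fJ: "finite J" using J assms(1) finite_subset by blast
  have cJ: "card (x ` J) = card J" using J assms(2) card_image inj_on_subset by blast
  have pos: "card J > 0" using J fJ by (simp add: card_gt_0_iff)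
  have "\<not> x ` J \<subseteq> {..<card J - 1}"
  proof
    assume "x ` J \<subseteq> {..<card J - 1}"
    then have "card (x ` J) \<le> card J - 1"
      using card_mono[of "{..<card J - 1}" "x ` J"] by simp
    then show False using cJ pos by simp
  qed
  then obtain i where "i \<in> J" "x i \<ge> card J - 1" by fastforce
  then show "\<exists>i\<in>J. card J \<le> card (A i)"
    using assms(3)[of i] J by (intro bexI[of _ i]) auto
qed

section \<open>Cyclic shifts\<close>

lemma inj_on_add_mod:
  fixes w :: nat
  shows "inj_on (\<lambda>a. (e + a) mod w) {..<w}"
proof (rule inj_onI)
  fix a b assume ab: "a \<in> {..<w}" "b \<in> {..<w}" "(e + a) mod w = (e + b) mod w"
  then obtain q r where "a + w * q = b + w * r" by (auto simp: nat_mod_eq_iff)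
  then have "a mod w = b mod w" by (metis mod_mult_self2)
  then show "a = b" using ab by simp
qed

lemma bij_betw_add_mod:
  fixes w :: nat
  shows "bij_betw (\<lambda>a. (e + a) mod w) {..<w} {..<w}"
proof -
  have "(\<lambda>a. (e + a) mod w) ` {..<w} \<subseteq> {..<w}" by auto
  then show ?thesis
    unfolding bij_betw_def using inj_on_add_mod[of e w] by (simp add: endo_inj_surj)
qed

section \<open>Young diagrams: heavy lines and rainbow matchings\<close>

definition down_closed :: "(nat \<times> nat) set \<Rightarrow> bool" where
  "down_closed D \<longleftrightarrow> (\<forall>x y x' y'. (x, y) \<in> D \<longrightarrow> x' \<le> x \<longrightarrow> y' \<le> y \<longrightarrow> (x', y') \<in> D)"

text \<open>For down-closed \<open>D\<close> and \<open>k > 0\<close>, the cell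
  \<open>(x, k - 1)\<close> lies in \<open>D\<close> iff the first \<open>k\<close> cells of row
  \<open>x\<close> do. The tag separates row \<open>x\<close> from column \<open>x\<close>, so that
  one choice of representatives can distribute lines of both kinds.\<close>

definition heavy :: "nat \<Rightarrow> (nat \<times> nat) set \<Rightarrow> (bool \<times> nat) set" where
  "heavy k D = {True} \<times> {x. x < k \<and> (x, k - 1) \<in> D} \<union> {False} \<times> {y. y < k \<and> (k - 1, y) \<in> D}"

lemma finite_heavy: "finite (heavy k D)"
  unfolding heavy_def by auto

lemma card_heavy:
  "card (heavy k D) = card {x. x < k \<and> (x, k - 1) \<in> D} + card {y. y < k \<and> (k - 1, y) \<in> D}"
  unfolding heavy_def by (subst card_Un_disjoint) (auto simp: card_cartesian_product)

text \<open>A cell with both coordinates at least \<open>k\<close> would force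
  \<open>(k - 1, k - 1)\<close> into \<open>D\<close>. So every cell outside the \<open>k\<close> by
  \<open>k\<close> square lies on a heavy line, and each heavy line has only \<open>n - k\<close>
  positions outside the square.\<close>

lemma card_down_closed_le:
  assumes D: "down_closed D" "D \<subseteq> {..<n} \<times> {..<n}" and k: "0 < k" "k \<le> n"
    and nf: "(k - 1, k - 1) \<notin> D"
  shows "card D \<le> card (D \<inter> {..<k} \<times> {..<k}) + (n - k) * card (heavy k D)"
proof -
  let ?R = "{x. x < k \<and> (x, k - 1) \<in> D}" and ?C = "{y. y < k \<and> (k - 1, y) \<in> D}"
  have "D \<subseteq> (D \<inter> {..<k} \<times> {..<k}) \<union> (?R \<times> {k..<n} \<union> {k..<n} \<times> ?C)" (is "_ \<subseteq> ?G \<union> (?P \<union> ?Q)")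
  proof
    fix p assume p: "p \<in> D"
    obtain x y where xy: "p = (x, y)" by (cases p)
    have low: "x' \<le> x \<Longrightarrow> y' \<le> y \<Longrightarrow> (x', y') \<in> D" for x' y'
      using D(1) p xy unfolding down_closed_def by blast
    have "x < n" "y < n" using D(2) p xy by auto
    moreover have "x < k \<or> y < k" using low[of "k - 1" "k - 1"] nf by linarith
    moreover have "(x, k - 1) \<in> D" if "k \<le> y" using low[of x "k - 1"] that by simp
    moreover have "(k - 1, y) \<in> D" if "k \<le> x" using low[of "k - 1" y] that by simp
    ultimately show "p \<in> ?G \<union> (?P \<union> ?Q)" using p xy by auto
  qed
  then have "card D \<le> card (?G \<union> (?P \<union> ?Q))" by (intro card_mono) auto
  also have "\<dots> \<le> card ?G + card (?P \<union> ?Q)" by (rule card_Un_le)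
  also have "\<dots> \<le> card ?G + (card ?P + card ?Q)" using card_Un_le[of ?P ?Q] by simp
  also have "\<dots> = card ?G + (n - k) * card (heavy k D)"
    unfolding card_heavy by (simp add: card_cartesian_product algebra_simps)
  finally show ?thesis .
qed

text \<open>The union bound, over the \<open>k\<^sup>2\<close> pairs of cyclic shifts of a bijection of \<open>K\<close> with \<open>{..<k}\<close>.\<close>

lemma dense_rainbow:
  fixes D :: "'i \<Rightarrow> (nat \<times> nat) set"
  assumes K: "finite K" "card K = k" "0 < k"
    and sub: "\<And>i. i \<in> K \<Longrightarrow> D i \<subseteq> {..<k} \<times> {..<k}"
    and big: "(\<Sum>i\<in>K. card (D i)) > k * k * (k - 1)"
  shows "\<exists>x y. inj_on x K \<and> inj_on y K \<and> (\<forall>i\<in>K. (x i, y i) \<in> D i)"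
proof -
  obtain e where e: "bij_betw e K {..<k}"
    using K ex_bij_betw_finite_nat[of K] by (auto simp: atLeast0LessThan)
  let ?S = "{..<k} \<times> {..<k}"
  let ?s = "\<lambda>i p. ((e i + fst p) mod k, (e i + snd p) mod k)"
  have fin: "finite (D i)" if "i \<in> K" for i using sub[OF that] finite_subset by blast
  have bij: "bij_betw (?s i) ?S ?S" for i
  proof -
    have "bij_betw (map_prod (\<lambda>a. (e i + a) mod k) (\<lambda>a. (e i + a) mod k)) ?S ?S"
      using bij_betw_add_mod[of "e i" k] by (simp add: bij_betw_map_prod)
    moreover have "map_prod (\<lambda>a. (e i + a) mod k) (\<lambda>a. (e i + a) mod k) = ?s i" by auto
    ultimately show ?thesis by simp
  qed
  \<comment> \<open>The shift pairs that fail for colour \<open>i\<close>. Since \<open>?s i\<close>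
    permutes the square, exactly \<open>k * k - card (D i)\<close> pairs fail.\<close>
  let ?B = "\<lambda>i. {p \<in> ?S. ?s i p \<notin> D i}"
  have B: "card (?B i) + card (D i) = k * k" if i: "i \<in> K" for i
  proof -
    have im: "?s i ` ?B i = ?S - D i"
    proof -
      have "f ` {p \<in> S. f p \<notin> T} = f ` S - T" for f :: "nat \<times> nat \<Rightarrow> nat \<times> nat" and S T
        by auto
      then show ?thesis using bij_betw_imp_surj_on[OF bij[of i]] by metis
    qed
    have "inj_on (?s i) (?B i)"
      by (rule inj_on_subset[OF bij_betw_imp_inj_on[OF bij[of i]]]) (rule Collect_restrict)
    from card_image[OF this] have "card (?B i) = card (?S - D i)" by (simp only: im)
    also have "\<dots> = k * k - card (D i)"
      using sub[OF i] fin[OF i] by (simp add: card_Diff_subset card_cartesian_product)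
    moreover have "card (D i) \<le> k * k"
      using card_mono[OF _ sub[OF i]] by (simp add: card_cartesian_product)
    ultimately show ?thesis by simp
  qed
  \<comment> \<open>The failures total less than \<open>k^3 - k^2 (k - 1) = k^2\<close>, the number
    of shift pairs, so some pair works for all colours at once.\<close>
  have "(\<Sum>i\<in>K. card (?B i)) + (\<Sum>i\<in>K. card (D i)) = k * (k * k)"
    using B K by (simp add: sum.distrib[symmetric])
  moreover have "k * (k * k) = k * k * (k - 1) + k * k"
    using K(3) by (cases k) (auto simp: algebra_simps)
  ultimately have "(\<Sum>i\<in>K. card (?B i)) < card ?S"
    using big by (simp add: card_cartesian_product)
  moreover have "card (\<Union>i\<in>K. ?B i) \<le> (\<Sum>i\<in>K. card (?B i))"
    by (rule card_UN_le[OF K(1)])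
  ultimately have "card (\<Union>i\<in>K. ?B i) < card ?S" by simp
  then have "\<not> ?S \<subseteq> (\<Union>i\<in>K. ?B i)"
    using card_mono[of "\<Union>i\<in>K. ?B i" ?S] K(1) by fastforce
  then obtain p where p: "p \<in> ?S" "\<And>i. i \<in> K \<Longrightarrow> ?s i p \<in> D i" by blast
  have inj: "inj_on (\<lambda>i. (e i + a) mod k) K" for a
  proof -
    have "inj_on ((\<lambda>b. (a + b) mod k) \<circ> e) K"
      using e inj_on_add_mod[of a k] unfolding bij_betw_def by (simp add: comp_inj_on)
    then show ?thesis by (simp add: comp_def add.commute)
  qed
  show ?thesis
    using inj p(2) by (intro exI[of _ "\<lambda>i. (e i + fst p) mod k"] exI[of _ "\<lambda>i. (e i + snd p) mod k"]) auto
qed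

text \<open>The values on \<open>M\<close> block at most \<open>card M\<close> of the
  \<open>k\<close> numbers below \<open>k\<close>, which leaves enough for \<open>K - M\<close>.
  Values on \<open>M\<close> itself may exceed \<open>k\<close>.\<close>

lemma extend_injection_below_card:
  fixes g :: "'i \<Rightarrow> nat"
  assumes "finite K" "card K = k" "M \<subseteq> K" "inj_on g M"
  shows "\<exists>g'. inj_on g' K \<and> (\<forall>i\<in>M. g' i = g i) \<and> (\<forall>i\<in>K - M. g' i < k)"
proof -
  have fM: "finite M" using assms finite_subset by blast
  have "card ({..<k} - g ` M) \<ge> k - card (g ` M)"
    using diff_card_le_card_Diff[of "g ` M" "{..<k}"] fM by simp
  moreover have "card (K - M) = k - card M" using assms fM by (simp add: card_Diff_subset)
  moreover have "card (g ` M) = card M" using assms(4) by (rule card_image)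
  ultimately have le: "card (K - M) \<le> card ({..<k} - g ` M)" by simp
  have "\<exists>h. inj_on h (K - M) \<and> (\<forall>i\<in>K - M. h i \<in> {..<k} - g ` M)"
  proof (rule greedy_representatives)
    show "finite (K - M)" using assms(1) by simp
    fix J assume "J \<subseteq> K - M" "J \<noteq> {}"
    moreover from this have "card J \<le> card (K - M)" using assms(1) by (simp add: card_mono)
    ultimately show "\<exists>i\<in>J. card J \<le> card ({..<k} - g ` M)" using le by fastforce
  qed
  then obtain h where h: "inj_on h (K - M)" "\<forall>i\<in>K - M. h i \<in> {..<k} - g ` M" by blast
  let ?g = "\<lambda>i. if i \<in> M then g i else h i"
  have "h ` (K - M) \<subseteq> - g ` M" by (rule image_subsetI) (use h(2) in simp)
  then have "inj_on ?g (M \<union> (K - M))"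
    by (intro inj_on_disjoint_Un[OF assms(4) h(1)]) blast
  moreover have "M \<union> (K - M) = K" using assms(3) by blast
  ultimately have "inj_on ?g K" by simp
  then show ?thesis using h(2) by (intro exI[of _ ?g]) auto
qed

text \<open>A heavy line fixes one coordinate of a colour outside \<open>I\<close>; the other
  coordinate may be any number below \<open>k\<close>, so it can be chosen last, avoiding all
  coordinates already taken.\<close>

lemma extend_by_heavy_lines:
  fixes D :: "'i \<Rightarrow> (nat \<times> nat) set"
  assumes K: "finite K" "card K = k" "I \<subseteq> K"
    and D: "\<And>i. i \<in> K \<Longrightarrow> down_closed (D i)"
    and xy: "inj_on x I" "inj_on y I" "\<And>i. i \<in> I \<Longrightarrow> (x i, y i) \<in> D i"
    and f: "inj_on f (K - I)"
      "\<And>i. i \<in> K - I \<Longrightarrow> f i \<in> heavy k (D i) - (Pair True ` x ` I \<union> Pair False ` y ` I)"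
  shows "\<exists>x y. inj_on x K \<and> inj_on y K \<and> (\<forall>i\<in>K. (x i, y i) \<in> D i)"
proof -
  \<comment> \<open>\<open>P\<close> collects the colours that hold a row and \<open>Q\<close> those
    that hold a column. First coordinates are thus prescribed on \<open>I \<union> P\<close>, second
    ones on \<open>I \<union> Q\<close>.\<close>
  define P where "P = {i \<in> K - I. fst (f i)}"
  define Q where "Q = {i \<in> K - I. \<not> fst (f i)}"
  let ?x = "\<lambda>i. if i \<in> I then x i else snd (f i)"
  let ?y = "\<lambda>i. if i \<in> I then y i else snd (f i)"
  have fP: "f i = (True, snd (f i))" if "i \<in> P" for i
    using that unfolding P_def by (simp add: prod_eq_iff)
  have fQ: "f i = (False, snd (f i))" if "i \<in> Q" for i
    using that unfolding Q_def by (simp add: prod_eq_iff)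
  have nx: "snd (f i) \<notin> x ` I" if "i \<in> P" for i
  proof -
    have "(True, snd (f i)) \<notin> Pair True ` x ` I" using f(2)[of i] fP[OF that] that unfolding P_def by auto
    then show ?thesis by blast
  qed
  have ny: "snd (f i) \<notin> y ` I" if "i \<in> Q" for i
  proof -
    have "(False, snd (f i)) \<notin> Pair False ` y ` I" using f(2)[of i] fQ[OF that] that unfolding Q_def by auto
    then show ?thesis by blast
  qed
  have sP: "inj_on (\<lambda>i. snd (f i)) P"
  proof (rule inj_onI)
    fix i j assume ij: "i \<in> P" "j \<in> P" "snd (f i) = snd (f j)"
    then have "f i = f j" using fP by metis
    then show "i = j" using f(1) ij unfolding P_def by (auto dest: inj_onD)
  qed
  have sQ: "inj_on (\<lambda>i. snd (f i)) Q"
  proof (rule inj_onI)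
    fix i j assume ij: "i \<in> Q" "j \<in> Q" "snd (f i) = snd (f j)"
    then have "f i = f j" using fQ by metis
    then show "i = j" using f(1) ij unfolding Q_def by (auto dest: inj_onD)
  qed
  have "(\<lambda>i. snd (f i)) ` P \<subseteq> - x ` I" by (rule image_subsetI) (simp add: nx)
  then have ix: "inj_on ?x (I \<union> P)"
    by (intro inj_on_disjoint_Un[OF xy(1) sP]) blast
  have "(\<lambda>i. snd (f i)) ` Q \<subseteq> - y ` I" by (rule image_subsetI) (simp add: ny)
  then have iy: "inj_on ?y (I \<union> Q)"
    by (intro inj_on_disjoint_Un[OF xy(2) sQ]) blast
  have "I \<union> P \<subseteq> K" "I \<union> Q \<subseteq> K" using K(3) unfolding P_def Q_def by auto
  obtain x' where x': "inj_on x' K" "\<forall>i\<in>I \<union> P. x' i = ?x i" "\<forall>i\<in>K - (I \<union> P). x' i < k"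
    using extend_injection_below_card[OF K(1,2) \<open>I \<union> P \<subseteq> K\<close> ix] by blast
  obtain y' where y': "inj_on y' K" "\<forall>i\<in>I \<union> Q. y' i = ?y i" "\<forall>i\<in>K - (I \<union> Q). y' i < k"
    using extend_injection_below_card[OF K(1,2) \<open>I \<union> Q \<subseteq> K\<close> iy] by blast
  have "(x' i, y' i) \<in> D i" if i: "i \<in> K" for i
  proof -
    have low: "(a', b') \<in> D i" if "(a, b) \<in> D i" "a' \<le> a" "b' \<le> b" for a b a' b'
      using D[OF i] that unfolding down_closed_def by blast
    consider "i \<in> I" | "i \<in> P" "i \<notin> I \<union> Q" | "i \<in> Q" "i \<notin> I \<union> P"
      using i unfolding P_def Q_def by blast
    then show ?thesis
    proof cases
      case 1
      then show ?thesis using x'(2) y'(2) xy(3) by simp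
    next
      case 2
      then have "(snd (f i), k - 1) \<in> D i"
        using f(2)[of i] fP[of i] unfolding heavy_def P_def by auto
      moreover have "x' i = snd (f i)" "y' i < k" using 2 x'(2) y'(3) i unfolding P_def by auto
      moreover from this have "y' i \<le> k - 1" by linarith
      ultimately show ?thesis using low by simp
    next
      case 3
      then have "(k - 1, snd (f i)) \<in> D i"
        using f(2)[of i] fQ[of i] unfolding heavy_def Q_def by auto
      moreover have "y' i = snd (f i)" "x' i < k" using 3 x'(3) y'(2) i unfolding Q_def by auto
      moreover from this have "x' i \<le> k - 1" by linarith
      ultimately show ?thesis using low by simp
    qed
  qed
  then show ?thesis using x'(1) y'(1) by blast
qed

text \<open>The density condition ranges over all nonempty \<open>I\<close> so that it passes to
  subsets of \<open>K\<close>; the induction is on \<open>card K\<close>, with \<open>n\<close>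
  fixed.\<close>

lemma down_closed_rainbow:
  fixes D :: "'i \<Rightarrow> (nat \<times> nat) set"
  assumes "finite K"
    and "\<And>i. i \<in> K \<Longrightarrow> down_closed (D i)"
    and "\<And>i. i \<in> K \<Longrightarrow> D i \<subseteq> {..<n} \<times> {..<n}"
    and "\<And>I. I \<subseteq> K \<Longrightarrow> I \<noteq> {} \<Longrightarrow> (\<Sum>i\<in>I. card (D i)) > card I * (card I - 1) * n"
  shows "\<exists>x y. inj_on x K \<and> inj_on y K \<and> (\<forall>i\<in>K. (x i, y i) \<in> D i)"
  using assms
proof (induction "card K" arbitrary: K rule: less_induct)
  case less
  have IH: "\<exists>x y. inj_on x I \<and> inj_on y I \<and> (\<forall>i\<in>I. (x i, y i) \<in> D i)" if "I \<subset> K" for I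
  proof (rule less.hyps)
    have IK: "I \<subseteq> K" using that by blast
    show "card I < card K" using that less.prems(1) by (rule psubset_card_mono[rotated])
    show "finite I" using IK less.prems(1) finite_subset by blast
    show "down_closed (D i)" "D i \<subseteq> {..<n} \<times> {..<n}" if "i \<in> I" for i
      using that IK less.prems(2,3) by blast+
    show "(\<Sum>i\<in>J. card (D i)) > card J * (card J - 1) * n" if "J \<subseteq> I" "J \<noteq> {}" for J
      using that IK by (intro less.prems(4)) auto
  qed
  define k where "k = card K"
  show ?case
  proof (cases "K = {}")
    case True
    then show ?thesis by simp
  next
    case nonempty: False
    then have k: "0 < k" unfolding k_def using less.prems(1) by (simp add: card_gt_0_iff)
    show ?thesis
    proof (cases "\<exists>i\<in>K. (k - 1, k - 1) \<in> D i")
      case True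
      then obtain i where i: "i \<in> K" "(k - 1, k - 1) \<in> D i" by blast
      obtain x y where xy: "inj_on x (K - {i})" "inj_on y (K - {i})" "\<forall>j\<in>K - {i}. (x j, y j) \<in> D j"
        using IH[of "K - {i}"] i(1) by blast
      obtain x' where x': "inj_on x' K" "\<forall>j\<in>K - {i}. x' j = x j" "\<forall>j\<in>K - (K - {i}). x' j < k"
        using extend_injection_below_card[OF less.prems(1) k_def[symmetric] _ xy(1)] by blast
      obtain y' where y': "inj_on y' K" "\<forall>j\<in>K - {i}. y' j = y j" "\<forall>j\<in>K - (K - {i}). y' j < k"
        using extend_injection_below_card[OF less.prems(1) k_def[symmetric] _ xy(2)] by blast
      have "x' i < k" "y' i < k" using x'(3) y'(3) i(1) by auto
      then have "x' i \<le> k - 1" "y' i \<le> k - 1" by linarith+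
      then have "(x' i, y' i) \<in> D i"
        using less.prems(2)[OF i(1)] i(2) unfolding down_closed_def by blast
      then have "\<forall>j\<in>K. (x' j, y' j) \<in> D j" using x'(2) y'(2) xy(3) by (metis DiffI singletonD)
      then show ?thesis using x'(1) y'(1) by blast
    next
      case False
      let ?h = "\<lambda>i. card (heavy k (D i))"
      define bad where "bad I \<longleftrightarrow> I \<subseteq> K \<and> sum ?h I \<le> card I * (card I - 1)" for I
      have "bad {}" unfolding bad_def by simp
      moreover have "\<forall>I. bad I \<longrightarrow> card I < Suc k"
        unfolding bad_def k_def using less.prems(1) by (simp add: card_mono le_imp_less_Suc)
      ultimately obtain I where I: "bad I" "\<And>J. bad J \<Longrightarrow> card J \<le> card I"
        using ex_has_greatest_nat[of bad "{}" card "Suc k"] by (metis less_imp_le)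
      have fI: "finite I" "I \<subseteq> K" using I(1) less.prems(1) finite_subset unfolding bad_def by auto
      show ?thesis
      proof (cases "I = K")
        case True
        have sumD: "(\<Sum>i\<in>K. card (D i)) > k * (k - 1) * n"
          using less.prems(4)[of K] nonempty unfolding k_def by simp
        \<comment> \<open>This makes the subtraction \<open>n - k\<close> exact. Otherwise the total
          size would be at most \<open>k * n^2\<close>, hence at most
          \<open>k * (k - 1) * n\<close>.\<close>
        have "k \<le> n"
        proof (rule ccontr)
          assume "\<not> k \<le> n"
          then have "n \<le> k - 1" by simp
          have "card (D i) \<le> n * n" if "i \<in> K" for i
            using card_mono[OF _ less.prems(3)[OF that]] by (simp add: card_cartesian_product)
          then have "(\<Sum>i\<in>K. card (D i)) \<le> k * (n * n)"
            using sum_bounded_above[of K "\<lambda>i. card (D i)" "n * n"] unfolding k_def by simp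
          also have "\<dots> \<le> k * (k - 1) * n" using \<open>n \<le> k - 1\<close> by simp
          finally show False using sumD by simp
        qed
        let ?G = "\<lambda>i. D i \<inter> {..<k} \<times> {..<k}"
        have "k * (k - 1) * n < (\<Sum>i\<in>K. card (D i))" by (rule sumD)
        also have "\<dots> \<le> (\<Sum>i\<in>K. card (?G i) + (n - k) * ?h i)"
        proof (rule sum_mono)
          fix i assume "i \<in> K"
          then show "card (D i) \<le> card (?G i) + (n - k) * ?h i"
            using card_down_closed_le[OF less.prems(2) less.prems(3) k \<open>k \<le> n\<close>] False by blast
        qed
        also have "\<dots> = (\<Sum>i\<in>K. card (?G i)) + (n - k) * sum ?h K"
          by (simp add: sum.distrib sum_distrib_left)
        also have "\<dots> \<le> (\<Sum>i\<in>K. card (?G i)) + (n - k) * (k * (k - 1))"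
          using I(1) True unfolding bad_def k_def by simp
        finally have "(\<Sum>i\<in>K. card (?G i)) + (n - k) * (k * (k - 1)) > k * (k - 1) * n" .
        \<comment> \<open>Writing \<open>n = (n - k) + k\<close> splits off the part that heavy
          lines can account for; what remains is the threshold of
          \<open>dense_rainbow\<close>.\<close>
        moreover have "k * (k - 1) * n = (n - k) * (k * (k - 1)) + k * k * (k - 1)"
        proof -
          have "n = (n - k) + k" using \<open>k \<le> n\<close> by simp
          then have "k * (k - 1) * n = k * (k - 1) * ((n - k) + k)" by metis
          then show ?thesis by (simp only: distrib_left ac_simps)
        qed
        ultimately have "(\<Sum>i\<in>K. card (?G i)) > k * k * (k - 1)" by linarith
        then have "\<exists>x y. inj_on x K \<and> inj_on y K \<and> (\<forall>i\<in>K. (x i, y i) \<in> ?G i)"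
          using dense_rainbow[OF less.prems(1) k_def[symmetric] k, of ?G] by auto
        then show ?thesis by blast
      next
        case False
        obtain x y where xy: "inj_on x I" "inj_on y I" "\<forall>i\<in>I. (x i, y i) \<in> D i"
          using IH[of I] False fI(2) by blast
        \<comment> \<open>The lines occupied by the matching of \<open>I\<close>: at most
          \<open>p\<close> rows and \<open>p\<close> columns.\<close>
        let ?U = "Pair True ` x ` I \<union> Pair False ` y ` I"
        define p where "p = card I"
        have "card (Pair True ` x ` I) \<le> p" "card (Pair False ` y ` I) \<le> p"
          unfolding p_def using fI(1) card_image_le le_trans finite_imageI by metis+
        then have U: "finite ?U" "card ?U \<le> 2 * p"
          using card_Un_le[of "Pair True ` x ` I" "Pair False ` y ` I"] fI(1) by auto
        have "\<exists>f. inj_on f (K - I) \<and> (\<forall>i\<in>K - I. f i \<in> heavy k (D i) - ?U)"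
        proof (rule greedy_representatives)
          show "finite (K - I)" using less.prems(1) by simp
          fix J assume J: "J \<subseteq> K - I" "J \<noteq> {}"
          define q where "q = card J"
          have fJ: "finite J" using J less.prems(1) finite_subset by blast
          have q: "0 < q" unfolding q_def using fJ J by (simp add: card_gt_0_iff)
          have dis: "I \<inter> J = {}" using J by blast
          have c: "card (I \<union> J) = p + q" unfolding p_def q_def
            using fI fJ dis by (simp add: card_Un_disjoint)
          \<comment> \<open>Maximality of \<open>I\<close> makes \<open>I \<union> J\<close> violate
            the bound. Subtracting the bound for \<open>I\<close> leaves more than
            \<open>q * (q + 2 * p - 1)\<close> for \<open>J\<close>, so some colour in
            \<open>J\<close> has at least \<open>q + 2 * p\<close> heavy lines, of which at most
            \<open>2 * p\<close> are occupied.\<close>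
          then have "\<not> bad (I \<union> J)" using I(2)[of "I \<union> J"] q p_def by auto
          then have "sum ?h (I \<union> J) > (p + q) * (p + q - 1)"
            using J fI c unfolding bad_def by auto
          moreover have "sum ?h (I \<union> J) = sum ?h I + sum ?h J"
            using fI fJ dis by (simp add: sum.union_disjoint)
          moreover have "sum ?h I \<le> p * (p - 1)" using I(1) unfolding bad_def p_def by simp
          moreover have "(p + q) * (p + q - 1) = p * (p - 1) + q * (q + 2 * p - 1)"
            using q by (cases p; cases q) (auto simp: algebra_simps)
          ultimately have big: "sum ?h J > q * (q + 2 * p - 1)" by linarith
          have "\<exists>i\<in>J. ?h i > q + 2 * p - 1"
          proof (rule ccontr)
            assume "\<not> ?thesis"
            then have "sum ?h J \<le> q * (q + 2 * p - 1)"
              using sum_bounded_above[of J ?h "q + 2 * p - 1"] unfolding q_def by (simp add: not_less)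
            then show False using big by simp
          qed
          then obtain i where i: "i \<in> J" "?h i > q + 2 * p - 1" by blast
          have "card (heavy k (D i) - ?U) \<ge> ?h i - card ?U"
            using U(1) by (rule diff_card_le_card_Diff)
          then have "q \<le> card (heavy k (D i) - ?U)" using i(2) U(2) by linarith
          then show "\<exists>i\<in>J. card J \<le> card (heavy k (D i) - ?U)" using i(1) q_def by blast
        qed
        then obtain f where "inj_on f (K - I)" "\<forall>i\<in>K - I. f i \<in> heavy k (D i) - ?U" by blast
        then show ?thesis
          using extend_by_heavy_lines[of K k I D x y f] less.prems(1,2) k_def fI(2) xy by blast
      qed
    qed
  qed
qed

section \<open>Compression of bipartite graphs\<close>

text \<open>Compressing each \<open>F i\<close> first along columns and then along rows gives a down-closed set of
  the same size, and a rainbow matching of the compressed sets pulls back by choosing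
  representatives twice.\<close>

theorem bipartite_rainbow:
  fixes F :: "'i \<Rightarrow> (nat \<times> nat) set"
  assumes K: "finite K"
    and sub: "\<And>i. i \<in> K \<Longrightarrow> F i \<subseteq> {..<n} \<times> {..<n}"
    and big: "\<And>I. I \<subseteq> K \<Longrightarrow> I \<noteq> {} \<Longrightarrow> (\<Sum>i\<in>I. card (F i)) > card I * (card I - 1) * n"
  shows "\<exists>x y. inj_on x K \<and> inj_on y K \<and> (\<forall>i\<in>K. (x i, y i) \<in> F i)"
proof -
  \<comment> \<open>\<open>d i y\<close> is the size of column \<open>y\<close>. Once the columns
    are pushed down, row \<open>x\<close> meets exactly the columns with \<open>x < d i y\<close>;
    pushing the rows as well leaves \<open>D i\<close>, with row lengths
    \<open>r i x\<close>.\<close>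
  define d where "d i y = card {x. (x, y) \<in> F i}" for i y
  define r where "r i x = card {y. y \<in> {..<n} \<and> x < d i y}" for i x
  define D where "D i = Sigma {..<n} (\<lambda>x. {..<r i x})" for i
  have d_le: "d i y \<le> n" if "i \<in> K" for i y
  proof -
    have "{x. (x, y) \<in> F i} \<subseteq> {..<n}" using sub[OF that] by auto
    from card_mono[OF _ this] show ?thesis unfolding d_def by simp
  qed
  have r_le: "r i x \<le> n" for i x
    unfolding r_def using card_mono[of "{..<n}" "{y. y \<in> {..<n} \<and> x < d i y}"] by auto
  have r_anti: "r i x \<le> r i x'" if "x' \<le> x" for i x x'
    unfolding r_def by (rule card_mono) (use that in auto)
  have card_D: "card (D i) = card (F i)" if i: "i \<in> K" for i
  proof -
    have "card (D i) = (\<Sum>x<n. r i x)"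
      unfolding D_def by simp
    also have "\<dots> = (\<Sum>x<n. \<Sum>y | y \<in> {..<n} \<and> x < d i y. 1)"
      unfolding r_def by simp
    also have "\<dots> = (\<Sum>y<n. \<Sum>x | x \<in> {..<n} \<and> x < d i y. 1)"
      by (rule sum.swap_restrict) auto
    also have "\<dots> = (\<Sum>y<n. d i y)"
    proof (rule sum.cong)
      fix y
      have "{x. x \<in> {..<n} \<and> x < d i y} = {..<d i y}" using d_le[OF i, of y] by auto
      then show "(\<Sum>x | x \<in> {..<n} \<and> x < d i y. 1) = d i y" by simp
    qed simp
    also have "\<dots> = card (Sigma {..<n} (\<lambda>y. {x. (x, y) \<in> F i}))"
    proof -
      have "finite {x. (x, y) \<in> F i}" for y
        by (rule finite_subset[of _ "{..<n}"]) (use sub[OF i] in auto)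
      then show ?thesis unfolding d_def by (simp add: card_SigmaI)
    qed
    also have "Sigma {..<n} (\<lambda>y. {x. (x, y) \<in> F i}) = (F i)\<inverse>" using sub[OF i] by auto
    finally show ?thesis by (simp add: card_inverse)
  qed
  have "\<exists>x y. inj_on x K \<and> inj_on y K \<and> (\<forall>i\<in>K. (x i, y i) \<in> D i)"
  proof (rule down_closed_rainbow[OF K])
    show "down_closed (D i)" for i
      unfolding down_closed_def D_def using r_anti by (auto intro: le_less_trans less_le_trans)
    show "D i \<subseteq> {..<n} \<times> {..<n}" for i
      unfolding D_def using r_le by (auto intro: less_le_trans)
    show "(\<Sum>i\<in>I. card (D i)) > card I * (card I - 1) * n" if I: "I \<subseteq> K" "I \<noteq> {}" for I
    proof -
      have "(\<Sum>i\<in>I. card (D i)) = (\<Sum>i\<in>I. card (F i))"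
        by (rule sum.cong) (use card_D I(1) in auto)
      then show ?thesis using big[OF I] by simp
    qed
  qed
  then obtain x y where xy: "inj_on x K" "inj_on y K" "\<forall>i\<in>K. (x i, y i) \<in> D i" by blast
  \<comment> \<open>The compressions are undone in reverse order: \<open>y i\<close> is a rank among
    the columns longer than \<open>x i\<close>, and then \<open>x i\<close> is a rank within the
    chosen column \<open>Y i\<close> of \<open>F i\<close>.\<close>
  have "\<exists>Y. inj_on Y K \<and> (\<forall>i\<in>K. Y i \<in> {y. y \<in> {..<n} \<and> x i < d i y})"
    by (rule representatives_of_ranks[OF K xy(2)]) (use xy(3) in \<open>auto simp: D_def r_def\<close>)
  then obtain Y where Y: "inj_on Y K" "\<forall>i\<in>K. x i < d i (Y i)" by blast
  have "\<exists>X. inj_on X K \<and> (\<forall>i\<in>K. X i \<in> {x. (x, Y i) \<in> F i})"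
    by (rule representatives_of_ranks[OF K xy(1)]) (use Y(2) in \<open>auto simp: d_def\<close>)
  then show ?thesis using Y(1) by blast
qed

section \<open>Distinct vertices with large links\<close>

text \<open>The injection maximising the total weight has the required property: otherwise the values
  on \<open>I\<close> could be improved by one of the cyclic injections of \<open>I\<close> into the vertices not used
  outside \<open>I\<close>.\<close>

lemma heavy_injection:
  fixes f :: "'i \<Rightarrow> nat \<Rightarrow> nat"
  assumes K: "finite K" "card K = k"
    and bound: "\<And>i v. i \<in> K \<Longrightarrow> f i v \<le> B"
    and big: "\<And>i. i \<in> K \<Longrightarrow> (\<Sum>v<n. f i v) > (k - 1) * B"
  shows "\<exists>v. inj_on v K \<and>
    (\<forall>I. I \<subseteq> K \<longrightarrow> I \<noteq> {} \<longrightarrow> card I * (card I - 1) * B < n * (\<Sum>i\<in>I. f i (v i)))"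
proof -
  \<comment> \<open>Needed for an injection of \<open>K\<close> into \<open>{..<n}\<close> to exist;
    with fewer vertices no colour could have weight above \<open>(k - 1) * B\<close>.\<close>
  have "k \<le> n"
  proof (rule ccontr)
    assume "\<not> k \<le> n"
    then have n: "n \<le> k - 1" and "K \<noteq> {}" using K(2) by auto
    then obtain i where i: "i \<in> K" by blast
    have "(\<Sum>v<n. f i v) \<le> n * B"
      using sum_bounded_above[of "{..<n}" "f i" B] bound[OF i] by simp
    also have "\<dots> \<le> (k - 1) * B" using n by simp
    finally show False using big[OF i] by simp
  qed
  define adm where "adm v \<longleftrightarrow> inj_on v K \<and> v ` K \<subseteq> {..<n}" for v :: "'i \<Rightarrow> nat"
  let ?w = "\<lambda>v. \<Sum>i\<in>K. f i (v i)"
  obtain e where e: "bij_betw e K {..<k}"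
    using K ex_bij_betw_finite_nat[of K] by (auto simp: atLeast0LessThan)
  then have "adm e" using \<open>k \<le> n\<close> unfolding adm_def bij_betw_def by auto
  \<comment> \<open>Admissible functions are arbitrary outside \<open>K\<close>, so there may be
    infinitely many; the bound \<open>k * B\<close> on the weight ensures that a maximum is
    attained.\<close>
  moreover have "\<forall>v. adm v \<longrightarrow> ?w v < Suc (k * B)"
    using sum_bounded_above[of K _ B] bound K(2) by (auto simp: less_Suc_eq_le)
  ultimately obtain v where v: "adm v" "\<And>u. adm u \<Longrightarrow> ?w u \<le> ?w v"
    using ex_has_greatest_nat[of adm e ?w "Suc (k * B)"] by (metis less_imp_le)
  have "card I * (card I - 1) * B < n * (\<Sum>i\<in>I. f i (v i))" if I: "I \<subseteq> K" "I \<noteq> {}" for I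
  proof -
    have fI: "finite I" using I K(1) finite_subset by blast
    define p where "p = card I"
    have p: "0 < p" "p \<le> k" unfolding p_def using fI I K by (auto simp: card_gt_0_iff card_mono)
    let ?V = "v ` (K - I)"
    define W where "W = {..<n} - ?V"
    have V: "?V \<subseteq> {..<n}" "card ?V = k - p"
    proof -
      show "?V \<subseteq> {..<n}" using v(1) unfolding adm_def by auto
      have "inj_on v (K - I)" using v(1) unfolding adm_def by (auto intro: inj_on_subset)
      then show "card ?V = k - p" using fI I K p_def by (simp add: card_image card_Diff_subset)
    qed
    define w where "w = card W"
    have w: "w = n - (k - p)"
      unfolding w_def W_def using V K(1) by (simp add: card_Diff_subset)
    then have "p \<le> w" using p \<open>k \<le> n\<close> by simp
    have "finite W" unfolding W_def by simp
    then obtain g where g: "bij_betw g {..<w} W"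
      using ex_bij_betw_nat_finite[of W] unfolding w_def by (auto simp: atLeast0LessThan)
    obtain c where c: "bij_betw c I {..<p}"
      using fI ex_bij_betw_finite_nat[of I] unfolding p_def by (auto simp: atLeast0LessThan)
    \<comment> \<open>For fixed \<open>a\<close> this is an injection of \<open>I\<close> into the
      free vertices \<open>W\<close>, since \<open>p \<le> w\<close>; for fixed \<open>i\<close> it
      runs through \<open>W\<close> exactly once as \<open>a\<close> varies.\<close>
    define s where "s a i = g ((a + c i) mod w)" for a i
    have s_bij: "bij_betw (\<lambda>a. s a i) {..<w} W" for i
    proof -
      have "bij_betw (g \<circ> (\<lambda>a. (c i + a) mod w)) {..<w} W"
        by (rule bij_betw_trans[OF bij_betw_add_mod g])
      then show ?thesis unfolding s_def comp_def by (simp add: add.commute)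
    qed
    have s_inj: "inj_on (s a) I" and s_W: "s a ` I \<subseteq> W" for a
    proof -
      have cI: "c ` I \<subseteq> {..<w}" using c \<open>p \<le> w\<close> unfolding bij_betw_def by auto
      have gm: "bij_betw (g \<circ> (\<lambda>b. (a + b) mod w)) {..<w} W"
        by (rule bij_betw_trans[OF bij_betw_add_mod g])
      have seq: "s a = (g \<circ> (\<lambda>b. (a + b) mod w)) \<circ> c" unfolding s_def comp_def by simp
      show "inj_on (s a) I" unfolding seq
        by (rule comp_inj_on[OF bij_betw_imp_inj_on[OF c] inj_on_subset[OF bij_betw_imp_inj_on[OF gm]]])
          (use cI in auto)
      show "s a ` I \<subseteq> W" unfolding seq using bij_betw_imp_surj_on[OF gm] cI by (metis image_comp image_mono)
    qed
    have le: "(\<Sum>i\<in>I. f i (s a i)) \<le> (\<Sum>i\<in>I. f i (v i))" for a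
    proof -
      let ?u = "\<lambda>i. if i \<in> I then s a i else v i"
      have vK: "inj_on v (K - I)" using v(1) unfolding adm_def by (auto intro: inj_on_subset)
      have "inj_on ?u (I \<union> (K - I))"
        by (rule inj_on_disjoint_Un[OF s_inj vK]) (use s_W[of a] W_def in blast)
      moreover have "I \<union> (K - I) = K" using I(1) by blast
      moreover have "?u ` K \<subseteq> {..<n}"
        using s_W[of a] v(1) unfolding adm_def W_def by auto
      ultimately have "adm ?u" unfolding adm_def by simp
      have split: "?w u = (\<Sum>i\<in>I. f i (u i)) + (\<Sum>i\<in>K - I. f i (u i))" for u
        using sum.subset_diff[OF I(1) K(1)] by (simp add: add.commute)
      have "?w ?u \<le> ?w v" using v(2)[OF \<open>adm ?u\<close>] .
      then show ?thesis unfolding split by simp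
    qed
    \<comment> \<open>Discarding \<open>k - p\<close> vertices, each of weight at most
      \<open>B\<close>, lowers the threshold from \<open>(k - 1) * B\<close> to
      \<open>(p - 1) * B\<close>.\<close>
    have W_sum: "(\<Sum>u\<in>W. f i u) > (p - 1) * B" if i: "i \<in> I" for i
    proof -
      have iK: "i \<in> K" using i I by blast
      have "(\<Sum>u<n. f i u) = (\<Sum>u\<in>W. f i u) + (\<Sum>u\<in>?V. f i u)"
        unfolding W_def by (rule sum.subset_diff[OF V(1)]) simp
      moreover have "(\<Sum>u\<in>?V. f i u) \<le> (k - p) * B"
        using sum_bounded_above[of ?V "f i" B] bound[OF iK] V(2) by simp
      moreover have "(k - 1) * B = (p - 1) * B + (k - p) * B"
        using p by (simp flip: distrib_right)
      ultimately show ?thesis using big[OF iK] by linarith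
    qed
    \<comment> \<open>Averaging: summing over all \<open>w\<close> shifts counts each weight on
      \<open>W\<close> once for every colour of \<open>I\<close>, while by maximality no shift beats
      \<open>v\<close>.\<close>
    have "p * (p - 1) * B = (\<Sum>i\<in>I. (p - 1) * B)" unfolding p_def by simp
    also have "\<dots> < (\<Sum>i\<in>I. \<Sum>u\<in>W. f i u)"
      by (rule sum_strict_mono[OF fI I(2) W_sum])
    also have "\<dots> = (\<Sum>i\<in>I. \<Sum>a<w. f i (s a i))"
    proof (rule sum.cong)
      fix i
      show "(\<Sum>u\<in>W. f i u) = (\<Sum>a<w. f i (s a i))"
        using sum.reindex_bij_betw[OF s_bij, of "f i" i] by simp
    qed simp
    also have "\<dots> = (\<Sum>a<w. \<Sum>i\<in>I. f i (s a i))" by (rule sum.swap)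
    also have "\<dots> \<le> w * (\<Sum>i\<in>I. f i (v i))"
      using sum_bounded_above[of "{..<w}" "\<lambda>a. \<Sum>i\<in>I. f i (s a i)"] le by simp
    also have "\<dots> \<le> n * (\<Sum>i\<in>I. f i (v i))" unfolding w by simp
    finally show ?thesis unfolding p_def .
  qed
  then show ?thesis using v(1) unfolding adm_def by blast
qed

section \<open>From links to triples\<close>

theorem tripartite_rainbow:
  fixes T :: "'i \<Rightarrow> (nat \<times> nat \<times> nat) set"
  assumes K: "finite K" "card K = k"
    and sub: "\<And>i. i \<in> K \<Longrightarrow> T i \<subseteq> {..<n} \<times> {..<n} \<times> {..<n}"
    and big: "\<And>i. i \<in> K \<Longrightarrow> card (T i) > (k - 1) * n ^ 2"
  shows "\<exists>v x y. inj_on v K \<and> inj_on x K \<and> inj_on y K \<and> (\<forall>i\<in>K. (v i, x i, y i) \<in> T i)"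
proof -
  let ?L = "\<lambda>i v. T i `` {v}"
  have L: "?L i v \<subseteq> {..<n} \<times> {..<n}" if "i \<in> K" for i v using sub[OF that] by auto
  have fin: "finite (?L i v)" if "i \<in> K" for i v using L[OF that] finite_subset by blast
  have "\<exists>v. inj_on v K \<and> (\<forall>I. I \<subseteq> K \<longrightarrow> I \<noteq> {} \<longrightarrow>
      card I * (card I - 1) * n ^ 2 < n * (\<Sum>i\<in>I. card (?L i (v i))))"
  proof (rule heavy_injection[OF K])
    show "card (?L i v) \<le> n ^ 2" if "i \<in> K" for i v
      using card_mono[OF _ L[OF that]] by (simp add: card_cartesian_product power2_eq_square)
    fix i assume i: "i \<in> K"
    have "T i = Sigma {..<n} (?L i)" using sub[OF i] by auto
    then have "card (T i) = (\<Sum>v<n. card (?L i v))"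
      using card_SigmaI[of "{..<n}" "?L i"] fin[OF i] by simp
    then show "(k - 1) * n ^ 2 < (\<Sum>v<n. card (?L i v))" using big[OF i] by simp
  qed
  then obtain v where v: "inj_on v K"
    "\<And>I. I \<subseteq> K \<Longrightarrow> I \<noteq> {} \<Longrightarrow> card I * (card I - 1) * n ^ 2 < n * (\<Sum>i\<in>I. card (?L i (v i)))"
    by blast
  have "\<exists>x y. inj_on x K \<and> inj_on y K \<and> (\<forall>i\<in>K. (x i, y i) \<in> ?L i (v i))"
  proof (rule bipartite_rainbow[OF K(1) L])
    fix I assume I: "I \<subseteq> K" "I \<noteq> {}"
    \<comment> \<open>With \<open>B = n^2\<close>, a factor \<open>n\<close> cancels and leaves
      exactly the density condition of the bipartite theorem for the links.\<close>
    have "n * (card I * (card I - 1) * n) < n * (\<Sum>i\<in>I. card (?L i (v i)))"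
      using v(2)[OF I] by (simp add: power2_eq_square ac_simps)
    then show "card I * (card I - 1) * n < (\<Sum>i\<in>I. card (?L i (v i)))"
      using mult_less_cancel1 by blast
  qed
  then show ?thesis using v(1) by auto
qed

section \<open>Triples and edges of the hypergraph\<close>

definition edge :: "nat \<times> nat \<times> nat \<Rightarrow> (nat \<times> nat) set" where
  "edge = (\<lambda>(a, b, c). {(1, a), (2, b), (3, c)})"

lemma complete_3partite_subset:
  "complete_3partite n \<subseteq> edge ` ({..<n} \<times> {..<n} \<times> {..<n})"
proof
  fix e assume e: "e \<in> complete_3partite n"
  have part: "\<exists>a<n. e \<inter> side n j = {(j, a)}" if "j \<in> {1, 2, 3}" for j
  proof -
    have "card (e \<inter> side n j) = 1" using e that unfolding complete_3partite_def by blast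
    then obtain q where q: "e \<inter> side n j = {q}" by (rule card_1_singletonE)
    then have "q \<in> side n j" by blast
    then show ?thesis using q unfolding side_def by auto
  qed
  obtain a b c where abc: "a < n" "b < n" "c < n" "e \<inter> side n 1 = {(1, a)}"
    "e \<inter> side n 2 = {(2, b)}" "e \<inter> side n 3 = {(3, c)}"
    using part[of 1] part[of 2] part[of 3] by auto
  have "e = e \<inter> side n 1 \<union> e \<inter> side n 2 \<union> e \<inter> side n 3"
    using e unfolding complete_3partite_def by blast
  also have "\<dots> = edge (a, b, c)" unfolding abc edge_def by auto
  finally have "e = edge (a, b, c)" .
  then show "e \<in> edge ` ({..<n} \<times> {..<n} \<times> {..<n})" using abc by blast
qed

theorem theorem1p12:
  fixes n k :: nat and F :: "nat \<Rightarrow> (nat \<times> nat) set set"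
  assumes "n \<ge> 1" and "k \<ge> 1"
    and "\<And>i. i < k \<Longrightarrow> F i \<subseteq> complete_3partite n"
    and "\<And>i. i < k \<Longrightarrow> card (F i) > (k - 1) * n ^ 2"
  shows "\<exists>e. rainbow_matching k F e"
proof -
  define T where "T i = {t \<in> {..<n} \<times> {..<n} \<times> {..<n}. edge t \<in> F i}" for i
  have T_sub: "T i \<subseteq> {..<n} \<times> {..<n} \<times> {..<n}" for i unfolding T_def by blast
  have "\<exists>v x y. inj_on v {..<k} \<and> inj_on x {..<k} \<and> inj_on y {..<k} \<and>
      (\<forall>i\<in>{..<k}. (v i, x i, y i) \<in> T i)"
  proof (rule tripartite_rainbow[OF _ _ T_sub])
    fix i assume "i \<in> {..<k}"
    then have i: "i < k" by simp
    \<comment> \<open>The triples in \<open>T i\<close> cover \<open>F i\<close> under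
      \<open>edge\<close>, so the lower bound on the size carries over to
      \<open>T i\<close>.\<close>
    have "F i \<subseteq> edge ` T i"
      using assms(3)[OF i] complete_3partite_subset[of n] unfolding T_def by blast
    moreover have "finite (T i)" using T_sub finite_subset by blast
    ultimately have "card (F i) \<le> card (T i)" by (rule surj_card_le[rotated])
    then show "(k - 1) * n ^ 2 < card (T i)" using assms(4)[OF i] by simp
  qed simp_all
  then obtain v x y where inj: "inj_on v {..<k}" "inj_on x {..<k}" "inj_on y {..<k}"
    and mem: "\<forall>i\<in>{..<k}. (v i, x i, y i) \<in> T i" by blast
  have "rainbow_matching k F (\<lambda>i. edge (v i, x i, y i))"
    unfolding rainbow_matching_def
  proof (intro conjI allI impI)
    show "edge (v i, x i, y i) \<in> F i" if "i < k" for i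
      using mem that unfolding T_def by blast
    fix i j assume "i < k" "j < k" "i \<noteq> j"
    then have "v i \<noteq> v j" "x i \<noteq> x j" "y i \<noteq> y j"
      using inj by (simp_all add: inj_on_contraD)
    then show "edge (v i, x i, y i) \<inter> edge (v j, x j, y j) = {}"
      unfolding edge_def by auto
  qed
  then show ?thesis by blast
qed

end
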